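(* A smooth projection of a knot is in spiral form if and only if it has the same number of local maxima with respect to every direction in the plane of projection.
   Context: A knot is a smooth simple closed curve $K$ in $\mathbb{R}^3$. A smooth projection is the orthogonal projection of $K$ to a plane, assumed to be an immersed closed curve. An inflection point of the projection is a point where the planar curvature vanishes; inflection points are assumed isolated. An inflection point is an $s$-inflection point if the signed planar curvature changes sign there. The projection is in spiral form if it has no $s$-inflection points. The number of local maxima of the projection, parametrized by $\alpha : S^1 \to \mathbb{R}^2$, with respect to a direction $w$ (a unit vector in the plane) is the number of local maxima of the function $t \mapsto \alpha(t)\cdot w$. *)

theory Defs
  imports "HOL-Analysis.Analysis" "HOL-Library.Extended_Nat"
begin

text \<open>
  The circle is identified with the reals modulo \<open>2\<pi>\<close>: a map from the circle is a function on
  the reals of period \<open>2\<pi>\<close>, and each point of the circle is represented exactly once by a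
  parameter in \<open>{0..<2 * pi}\<close>. Derivatives, limits and neighbourhoods at such a point (also at
  \<open>0\<close>) are those of the periodic function on the whole line.
\<close>

definition nth_vector_derivative ::
    "nat \<Rightarrow> (real \<Rightarrow> 'a::real_normed_vector) \<Rightarrow> real \<Rightarrow> 'a" where
  "nth_vector_derivative k f = ((\<lambda>g t. vector_derivative g (at t)) ^^ k) f"

definition smooth_curve :: "(real \<Rightarrow> 'a::real_normed_vector) \<Rightarrow> bool" where
  "smooth_curve f \<longleftrightarrow> (\<forall>k t. nth_vector_derivative k f differentiable (at t))"

definition immersed_closed_curve :: "(real \<Rightarrow> 'a::real_normed_vector) \<Rightarrow> bool" where
  "immersed_closed_curve f \<longleftrightarrow>
     smooth_curve f \<and> (\<forall>t. f (t + 2 * pi) = f t) \<and> (\<forall>t. vector_derivative f (at t) \<noteq> 0)"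

definition knot_parametrization :: "(real \<Rightarrow> real^3) \<Rightarrow> (real^3) set \<Rightarrow> bool" where
  "knot_parametrization \<gamma> K \<longleftrightarrow>
     immersed_closed_curve \<gamma> \<and> inj_on \<gamma> {0..<2 * pi} \<and> K = range \<gamma>"

text \<open>
  A plane in space is given by a point \<open>p\<close> on it and an orthonormal pair \<open>e1\<close>, \<open>e2\<close> of direction
  vectors; \<open>plane_projection p e1 e2 q\<close> is the orthogonal projection of \<open>q\<close> to that plane, written
  in the resulting Cartesian coordinates (see the two lemmas below).
\<close>

definition orthonormal_pair :: "real^3 \<Rightarrow> real^3 \<Rightarrow> bool" where
  "orthonormal_pair e1 e2 \<longleftrightarrow> norm e1 = 1 \<and> norm e2 = 1 \<and> orthogonal e1 e2"

definition plane_point :: "real^3 \<Rightarrow> real^3 \<Rightarrow> real^3 \<Rightarrow> real^2 \<Rightarrow> real^3" where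
  "plane_point p e1 e2 x = p + (x $ 1) *\<^sub>R e1 + (x $ 2) *\<^sub>R e2"

definition plane_projection :: "real^3 \<Rightarrow> real^3 \<Rightarrow> real^3 \<Rightarrow> real^3 \<Rightarrow> real^2" where
  "plane_projection p e1 e2 q = vector [(q - p) \<bullet> e1, (q - p) \<bullet> e2]"

lemma dist_plane_point:
  assumes "orthonormal_pair e1 e2"
  shows "dist (plane_point p e1 e2 x) (plane_point p e1 e2 y) = dist x y"
proof -
  have o: "e1 \<bullet> e1 = 1" "e2 \<bullet> e2 = 1" "e1 \<bullet> e2 = 0" "e2 \<bullet> e1 = 0"
    using assms by (auto simp: orthonormal_pair_def orthogonal_def norm_eq_1 inner_commute)
  have d: "plane_point p e1 e2 x - plane_point p e1 e2 y
      = (x $ 1 - y $ 1) *\<^sub>R e1 + (x $ 2 - y $ 2) *\<^sub>R e2"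
    by (simp add: plane_point_def algebra_simps)
  have l: "(a *\<^sub>R e1 + b *\<^sub>R e2) \<bullet> (a *\<^sub>R e1 + b *\<^sub>R e2) = a * a + b * b" for a b
    by (simp add: inner_add_left inner_add_right o)
  have r: "(x - y) \<bullet> (x - y) = (x $ 1 - y $ 1) * (x $ 1 - y $ 1) + (x $ 2 - y $ 2) * (x $ 2 - y $ 2)"
    by (simp add: inner_vec_def sum_2)
  show ?thesis
    unfolding dist_norm norm_eq d l r ..
qed

lemma plane_projection_orthogonal:
  assumes "orthonormal_pair e1 e2"
  shows "orthogonal (q - plane_point p e1 e2 (plane_projection p e1 e2 q))
           (plane_point p e1 e2 x - plane_point p e1 e2 y)"
proof -
  have o: "e1 \<bullet> e1 = 1" "e2 \<bullet> e2 = 1" "e1 \<bullet> e2 = 0" "e2 \<bullet> e1 = 0"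
    using assms by (auto simp: orthonormal_pair_def orthogonal_def norm_eq_1 inner_commute)
  show ?thesis
    by (simp add: orthogonal_def plane_point_def plane_projection_def o inner_add_left
        inner_add_right inner_diff_left inner_diff_right algebra_simps)
qed

definition signed_curvature :: "(real \<Rightarrow> real^2) \<Rightarrow> real \<Rightarrow> real" where
  "signed_curvature \<alpha> t =
     (let v = nth_vector_derivative 1 \<alpha> t; a = nth_vector_derivative 2 \<alpha> t
      in (v $ 1 * a $ 2 - v $ 2 * a $ 1) / norm v ^ 3)"

definition inflection_points :: "(real \<Rightarrow> real^2) \<Rightarrow> real set" where
  "inflection_points \<alpha> = {t. signed_curvature \<alpha> t = 0}"

definition changes_sign_at :: "(real \<Rightarrow> real) \<Rightarrow> real \<Rightarrow> bool" where
  "changes_sign_at f t \<longleftrightarrow>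
     (\<forall>\<^sub>F s in at_left t. f s < 0) \<and> (\<forall>\<^sub>F s in at_right t. f s > 0) \<or>
     (\<forall>\<^sub>F s in at_left t. f s > 0) \<and> (\<forall>\<^sub>F s in at_right t. f s < 0)"

definition s_inflection_points :: "(real \<Rightarrow> real^2) \<Rightarrow> real set" where
  "s_inflection_points \<alpha> = {t \<in> inflection_points \<alpha>. changes_sign_at (signed_curvature \<alpha>) t}"

definition spiral_form :: "(real \<Rightarrow> real^2) \<Rightarrow> bool" where
  "spiral_form \<alpha> \<longleftrightarrow> s_inflection_points \<alpha> = {}"

definition is_local_max :: "(real \<Rightarrow> real) \<Rightarrow> real \<Rightarrow> bool" where
  "is_local_max f t \<longleftrightarrow> (\<forall>\<^sub>F s in nhds t. f s \<le> f t)"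

text \<open>The count takes values in \<open>enat\<close> because \<open>card\<close> would give 0 for an infinite set.\<close>

definition num_local_maxima :: "(real \<Rightarrow> real^2) \<Rightarrow> real^2 \<Rightarrow> enat" where
  "num_local_maxima \<alpha> w =
     (let M = {t \<in> {0..<2 * pi}. is_local_max (\<lambda>t. \<alpha> t \<bullet> w) t}
      in if finite M then enat (card M) else \<infinity>)"

end

(*
  Write the velocity as \<rho> (cos \<theta>, sin \<theta>) with a smooth tangent angle \<theta>; then \<theta>' is the signed
  curvature times the speed, and the height function f in the direction (cos \<phi>, sin \<phi>) has
  derivative \<rho> cos (\<theta> - \<phi>).

  If the curvature never changes sign, then \<theta> is strictly monotone, and the local maxima of f are the
  parameters where \<theta> passes one fixed residue class modulo 2\<pi>. Their number is the absolute value
  of the turning number, whatever \<phi> is.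

  If the curvature changes sign at t0, choose \<phi> so that the direction is normal to the curve at t0
  and f is strictly increasing near t0 although f'(t0) = 0. The finitely many local maxima of f are
  strict, so they survive a small rotation of the direction, and rotating to the side where f'(t0)
  becomes negative creates one more near t0. Comparing with the critical direction itself, and not the
  two sides of it with each other, is what excludes cancellation between several s-inflection points
  with the same normal direction.
*)

theory Submission
  imports Defs
begin

section \<open>Strict comparison, sign and periodicity facts for functions of one real
  variable\<close>

section \<open>Real functions near a point\<close>

text \<open>Turning one-sided neighbourhoods of different points into conditions on a positive
  distance \<open>d\<close> lets finitely many of them share one radius later.\<close>

lemma eventually_at_left_to_right_0:
  fixes t :: real
  assumes "\<forall>\<^sub>F s in at_left t. P s"
  shows "\<forall>\<^sub>F d in at_right 0. P (t - d)"
proof -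
  obtain b where b: "b < t" "\<And>s. b < s \<Longrightarrow> s < t \<Longrightarrow> P s"
    using assms by (auto simp: eventually_at_left_field)
  have "\<forall>d>0. d < t - b \<longrightarrow> P (t - d)" using b by auto
  then show ?thesis
    using b(1) unfolding eventually_at_right_field by (intro exI[of _ "t - b"]) auto
qed

lemma eventually_at_right_to_right_0:
  fixes t :: real
  assumes "\<forall>\<^sub>F s in at_right t. P s"
  shows "\<forall>\<^sub>F d in at_right 0. P (t + d)"
  using assms by (simp add: eventually_at_right_to_0[of _ t] add.commute)

lemma eventually_deriv_pos_imp_greater_right:
  fixes F :: "real \<Rightarrow> real"
  assumes F: "\<And>s. (F has_real_derivative F' s) (at s)"
    and pos: "\<forall>\<^sub>F s in at_right t. F' s > 0"
  shows "\<forall>\<^sub>F s in at_right t. F t < F s"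
proof -
  obtain b where b: "t < b" "\<And>s. t < s \<Longrightarrow> s < b \<Longrightarrow> F' s > 0"
    using pos by (auto simp: eventually_at_right_field)
  have "F t < F s" if "t < s" "s < b" for s
  proof (rule DERIV_pos_imp_increasing_open[OF that(1)])
    show "\<exists>y. (F has_real_derivative y) (at x) \<and> 0 < y" if "t < x" "x < s" for x
      using F b(2) that \<open>s < b\<close> by (meson less_trans)
    show "continuous_on {t..s} F"
      using F by (meson DERIV_isCont continuous_at_imp_continuous_on)
  qed
  then show ?thesis using b(1) by (auto simp: eventually_at_right_field)
qed

lemma eventually_deriv_pos_imp_less_left:
  fixes F :: "real \<Rightarrow> real"
  assumes F: "\<And>s. (F has_real_derivative F' s) (at s)"
    and pos: "\<forall>\<^sub>F s in at_left t. F' s > 0"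
  shows "\<forall>\<^sub>F s in at_left t. F s < F t"
proof -
  obtain b where b: "b < t" "\<And>s. b < s \<Longrightarrow> s < t \<Longrightarrow> F' s > 0"
    using pos by (auto simp: eventually_at_left_field)
  have "F s < F t" if "b < s" "s < t" for s
  proof (rule DERIV_pos_imp_increasing_open[OF that(2)])
    show "\<exists>y. (F has_real_derivative y) (at x) \<and> 0 < y" if "s < x" "x < t" for x
      using F b(2) that \<open>b < s\<close> by (meson less_trans)
    show "continuous_on {s..t} F"
      using F by (meson DERIV_isCont continuous_at_imp_continuous_on)
  qed
  then show ?thesis using b(1) by (auto simp: eventually_at_left_field)
qed

lemma eventually_deriv_pos_neg_imp_less:
  fixes F :: "real \<Rightarrow> real"
  assumes F: "\<And>s. (F has_real_derivative F' s) (at s)"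
    and "\<forall>\<^sub>F s in at_left t. F' s > 0" and "\<forall>\<^sub>F s in at_right t. F' s < 0"
  shows "\<forall>\<^sub>F s in at t. F s < F t"
proof -
  have "\<And>s. ((\<lambda>s. - F s) has_real_derivative - F' s) (at s)"
    using F by (intro DERIV_minus)
  then have "\<forall>\<^sub>F s in at_right t. - F t < - F s"
    using assms(3) by (intro eventually_deriv_pos_imp_greater_right) auto
  then show ?thesis
    using eventually_deriv_pos_imp_less_left[OF F assms(2)] by (simp add: eventually_at_split)
qed

text \<open>By the mean value theorem, a nearby second point with value \<open>F t\<close> would
  force a zero of \<open>F'\<close> strictly between the two points.\<close>

lemma eventually_neq_of_eventually_deriv_nonzero:
  fixes F :: "real \<Rightarrow> real"
  assumes F: "\<And>s. (F has_real_derivative F' s) (at s)"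
    and nz: "\<forall>\<^sub>F s in at t. F' s \<noteq> 0"
  shows "\<forall>\<^sub>F s in at t. F s \<noteq> F t"
proof -
  obtain d where d: "d > 0" "\<And>s. s \<noteq> t \<Longrightarrow> dist s t < d \<Longrightarrow> F' s \<noteq> 0"
    using nz by (auto simp: eventually_at)
  have no: "F a \<noteq> F b" if "a < b" "a = t \<or> b = t" "b - a < d" for a b
  proof
    assume "F a = F b"
    have "\<exists>z>a. z < b \<and> F b - F a = (b - a) * F' z"
      by (rule MVT2[OF that(1)]) (rule F)
    then obtain z where "a < z" "z < b" "F b - F a = (b - a) * F' z"
      by blast
    then show False using \<open>F a = F b\<close> d(2)[of z] that by (auto simp: dist_real_def)
  qed
  have "F s \<noteq> F t" if "s \<noteq> t" "dist s t < d" for s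
  proof (cases "s < t")
    case True
    then show ?thesis using no[of s t] that by (auto simp: dist_real_def)
  next
    case False
    then show ?thesis using no[of t s] that by (auto simp: dist_real_def)
  qed
  then show ?thesis using d(1) by (auto simp: eventually_at)
qed

text \<open>A maximum over the compact interval cannot sit at an endpoint, since \<open>c\<close> is
  higher. All local maxima for a rotated direction are found this way.\<close>

lemma local_max_between:
  fixes f :: "real \<Rightarrow> real"
  assumes "a < c" "c < b" and cont: "continuous_on {a..b} f" and "f a < f c" "f b < f c"
  shows "\<exists>s. a < s \<and> s < b \<and> is_local_max f s"
proof -
  obtain s where s: "s \<in> {a..b}" "\<And>y. y \<in> {a..b} \<Longrightarrow> f y \<le> f s"
    using continuous_attains_sup[OF compact_Icc _ cont] assms(1,2) by fastforce
  have "f c \<le> f s" using s(2)[of c] assms by auto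
  then have "s \<noteq> a" "s \<noteq> b" using assms by auto
  then have ab: "a < s" "s < b" using s(1) by auto
  have "\<forall>\<^sub>F y in nhds s. y \<in> {a<..<b}"
    using ab by (intro eventually_nhds_in_open) auto
  then have "is_local_max f s"
    unfolding is_local_max_def by eventually_elim (use s(2) in auto)
  then show ?thesis using ab by blast
qed

lemma eventually_less_of_isCont:
  fixes g h :: "real \<Rightarrow> real"
  assumes "isCont g x" "isCont h x" "g x < h x"
  shows "\<forall>\<^sub>F y in nhds x. g y < h y"
proof -
  have "isCont (\<lambda>y. h y - g y) x" using assms by (intro continuous_intros)
  then have "((\<lambda>y. h y - g y) \<longlongrightarrow> h x - g x) (nhds x)"
    using tendsto_at_iff_tendsto_nhds[of "\<lambda>y. h y - g y" x] by (simp add: isCont_def)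
  then have "\<forall>\<^sub>F y in nhds x. 0 < h y - g y"
    using assms(3) by (intro order_tendstoD(1)) auto
  then show ?thesis by simp
qed

text \<open>The sine is 1-Lipschitz; this limits how much the separation of two points on the circle
  changes when both are moved slightly.\<close>

lemma abs_sin_diff_le: "\<bar>sin x - sin y\<bar> \<le> \<bar>x - y\<bar>" for x y :: real
proof -
  have "sin x - sin y = 2 * sin ((x - y) / 2) * cos ((x + y) / 2)"
    by (rule sin_diff_sin)
  also have "\<bar>\<dots>\<bar> \<le> 2 * \<bar>sin ((x - y) / 2)\<bar> * 1"
    unfolding abs_mult by (intro mult_mono) auto
  also have "\<dots> \<le> \<bar>x - y\<bar>"
    using abs_sin_x_le_abs_x[of "(x - y) / 2"] by simp
  finally show ?thesis .
qed

lemma periodic_int: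
  fixes f :: "real \<Rightarrow> 'a"
  assumes "\<And>t. f (t + p) = f t"
  shows "f (t + of_int k * p) = f t"
proof (induction k rule: int_induct[of _ 0])
  case (step1 i)
  then show ?case using assms[of "t + of_int i * p"] by (simp add: algebra_simps)
next
  case (step2 i)
  then show ?case using assms[of "t + of_int (i - 1) * p"] by (simp add: algebra_simps)
qed simp

lemma is_local_max_shift:
  assumes "is_local_max f t" and per: "\<And>s. f (s + c) = f s"
  shows "is_local_max f (t + c)"
proof -
  obtain d where d: "d > 0" "\<And>s. dist s t < d \<Longrightarrow> f s \<le> f t"
    using assms(1) by (auto simp: is_local_max_def eventually_nhds_metric)
  have "f s \<le> f (t + c)" if "dist s (t + c) < d" for s
    using d(2)[of "s - c"] per[of "s - c"] per[of t] that by (simp add: dist_real_def algebra_simps)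
  then show ?thesis using d(1) unfolding is_local_max_def eventually_nhds_metric by blast
qed

text \<open>The subtraction formula gives \<open>sin (a - b) = 0\<close>, and distinct zeros of the
  sine are at least \<open>pi\<close> apart.\<close>

lemma cos_zeros_close:
  fixes a b :: real
  assumes "cos a = 0" "cos b = 0" "\<bar>a - b\<bar> < pi"
  shows "a = b"
proof -
  have "sin (a - b) = 0" using assms by (simp add: sin_diff)
  then show ?thesis using assms(3) sin_eq_0_pi[of "a - b"] by (simp add: abs_less_iff)
qed

lemma constant_sign_between:
  fixes f :: "real \<Rightarrow> real"
  assumes "continuous_on {a<..<b} f" and "\<And>s. a < s \<Longrightarrow> s < b \<Longrightarrow> f s \<noteq> 0"
  shows "(\<forall>s. a < s \<and> s < b \<longrightarrow> f s > 0) \<or> (\<forall>s. a < s \<and> s < b \<longrightarrow> f s < 0)"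
proof (rule ccontr)
  assume "\<not> ?thesis"
  then obtain x y where xy: "x \<in> {a<..<b}" "y \<in> {a<..<b}" "f x \<le> 0" "0 \<le> f y"
    by (auto simp: not_less)
  have "connected (f ` {a<..<b})"
    by (rule connected_continuous_image[OF assms(1)]) (rule connected_Ioo)
  then have "0 \<in> f ` {a<..<b}"
    by (rule connectedD_interval[of _ "f x" "f y"]) (use xy in auto)
  then show False using assms(2) by auto
qed

lemma eventually_sign_right:
  fixes f :: "real \<Rightarrow> real"
  assumes "\<And>s. isCont f s" and "\<forall>\<^sub>F s in at_right t. f s \<noteq> 0"
  shows "(\<forall>\<^sub>F s in at_right t. f s > 0) \<or> (\<forall>\<^sub>F s in at_right t. f s < 0)"
proof -
  obtain b where b: "t < b" "\<And>s. t < s \<Longrightarrow> s < b \<Longrightarrow> f s \<noteq> 0"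
    using assms(2) by (auto simp: eventually_at_right_field)
  show ?thesis
    using constant_sign_between[of t b f, OF continuous_at_imp_continuous_on b(2)] assms(1) b(1)
    unfolding eventually_at_right_field by blast
qed

lemma eventually_sign_left:
  fixes f :: "real \<Rightarrow> real"
  assumes "\<And>s. isCont f s" and "\<forall>\<^sub>F s in at_left t. f s \<noteq> 0"
  shows "(\<forall>\<^sub>F s in at_left t. f s > 0) \<or> (\<forall>\<^sub>F s in at_left t. f s < 0)"
proof -
  obtain b where b: "b < t" "\<And>s. b < s \<Longrightarrow> s < t \<Longrightarrow> f s \<noteq> 0"
    using assms(2) by (auto simp: eventually_at_left_field)
  show ?thesis
    using constant_sign_between[of b t f, OF continuous_at_imp_continuous_on b(2)] assms(1) b(1)
    unfolding eventually_at_left_field by blast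
qed

text \<open>One open neighbourhood of \<open>t\<close> serves all its points, with \<open>t\<close>
  itself removed for the others. Hence the set of points with a given sign nearby is open even if
  the function has isolated zeros.\<close>

lemma open_eventually_at:
  fixes P :: "'a::t1_space \<Rightarrow> bool"
  shows "open {t. \<forall>\<^sub>F s in at t. P s}"
proof (subst open_subopen, safe)
  fix t assume "\<forall>\<^sub>F s in at t. P s"
  then obtain U where U: "open U" "t \<in> U" "\<And>s. s \<in> U \<Longrightarrow> s \<noteq> t \<Longrightarrow> P s"
    by (auto simp: eventually_at_topological)
  have "\<forall>\<^sub>F s in at x. P s" if "x \<in> U" for x
  proof (cases "x = t")
    case True
    then show ?thesis using U by (auto simp: eventually_at_topological)
  next
    case False
    then show ?thesis
      using U that unfolding eventually_at_topological by (intro exI[of _ "U - {t}"]) auto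
  qed
  then show "\<exists>T. open T \<and> t \<in> T \<and> T \<subseteq> {t. \<forall>\<^sub>F s in at t. P s}"
    using U by blast
qed

text \<open>By continuity a nonzero value keeps its sign on both sides of \<open>t\<close>,
  contradicting the opposite one-sided signs.\<close>

lemma changes_sign_at_imp_zero:
  assumes "isCont f t" "changes_sign_at f t"
  shows "f t = 0"
proof (rule ccontr)
  assume "f t \<noteq> 0"
  then consider "f t < 0" | "f t > 0" by linarith
  then have "(\<forall>\<^sub>F s in at t. f s < 0) \<or> (\<forall>\<^sub>F s in at t. f s > 0)"
    using assms(1) unfolding isCont_def by cases (auto dest: order_tendstoD)
  moreover have False if "\<forall>\<^sub>F s in F. f s < 0" "\<forall>\<^sub>F s in F. f s > 0" "F \<noteq> bot" for F
  proof -
    have "\<forall>\<^sub>F s in F. False" using that(1,2) by eventually_elim simp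
    then show False using that(3) by simp
  qed
  ultimately show False
    using assms(2) trivial_limit_at_left_real[of t] trivial_limit_at_right_real[of t]
    unfolding changes_sign_at_def eventually_at_split by blast
qed

lemma eventually_at_pos_imp_nonneg:
  fixes f :: "real \<Rightarrow> real"
  assumes "isCont f t" "\<forall>\<^sub>F s in at t. f s > 0"
  shows "0 \<le> f t"
  using assms unfolding isCont_def
  by (intro tendsto_lowerbound[of f "f t" "at t" 0]) (auto elim: eventually_mono)

section \<open>Critical points and local maxima of height functions\<close>

section \<open>Height functions of a curve with a tangent angle\<close>

text \<open>Describing a direction by its angle turns a rotation of the direction into a shift of
  \<open>\<phi>\<close> in the slope factor \<open>cos (\<theta> t - \<phi>)\<close>.\<close>

definition dir :: "real \<Rightarrow> real^2" where
  "dir \<phi> = vector [cos \<phi>, sin \<phi>]"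

lemma inner_dir: "x \<bullet> dir \<phi> = x $ 1 * cos \<phi> + x $ 2 * sin \<phi>"
  by (simp add: dir_def inner_vec_def sum_2)

lemma norm_dir: "norm (dir \<phi>) = 1"
  by (simp add: norm_eq_1 inner_dir) (simp add: dir_def flip: power2_eq_square)

lemma dir_exists:
  fixes w :: "real^2"
  assumes "norm w = 1"
  obtains \<phi> where "w = dir \<phi>"
proof -
  have "(w $ 1)\<^sup>2 + (w $ 2)\<^sup>2 = 1"
    using assms by (simp add: norm_eq_1 inner_vec_def sum_2 power2_eq_square)
  then obtain \<phi> where "w $ 1 = cos \<phi>" "w $ 2 = sin \<phi>"
    using sincos_total_2pi by metis
  then have "w = dir \<phi>" by (simp add: vec_eq_iff forall_2 dir_def)
  then show ?thesis by (rule that)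
qed

text \<open>Here \<open>\<rho>\<close> is the speed, \<open>\<theta>\<close> a tangent angle lifted
  to the real line and \<open>\<omega>\<close> its derivative. Periodicity is assumed of
  \<open>\<alpha>\<close> only: over one period \<open>\<theta>\<close> gains a multiple of
  \<open>2 * pi\<close>.\<close>

locale curve_with_tangent_angle =
  fixes \<alpha> :: "real \<Rightarrow> real^2" and \<rho> \<theta> \<omega> :: "real \<Rightarrow> real"
  assumes deriv_curve:
      "\<And>t. (\<alpha> has_vector_derivative vector [\<rho> t * cos (\<theta> t), \<rho> t * sin (\<theta> t)]) (at t)"
    and speed_pos: "\<And>t. \<rho> t > 0"
    and deriv_angle: "\<And>t. (\<theta> has_real_derivative \<omega> t) (at t)"
    and angular_speed_cont: "\<And>t. isCont \<omega> t"
    and angular_speed_zeros_isolated: "\<And>t. \<forall>\<^sub>F s in at t. \<omega> s \<noteq> 0"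
    and periodic: "\<And>t. \<alpha> (t + 2 * pi) = \<alpha> t"
begin

lemma height_deriv:
  "((\<lambda>t. \<alpha> t \<bullet> dir \<phi>) has_real_derivative \<rho> t * cos (\<theta> t - \<phi>)) (at t)"
proof -
  have "((\<lambda>t. \<alpha> t \<bullet> dir \<phi>) has_vector_derivative
      vector [\<rho> t * cos (\<theta> t), \<rho> t * sin (\<theta> t)] \<bullet> dir \<phi>) (at t)"
    by (rule bounded_linear.has_vector_derivative[OF bounded_linear_inner_left deriv_curve])
  then show ?thesis
    by (simp add: has_real_derivative_iff_has_vector_derivative inner_dir cos_diff algebra_simps)
qed

lemma height_periodic: "\<alpha> (t + of_int k * (2 * pi)) \<bullet> dir \<phi> = \<alpha> t \<bullet> dir \<phi>"
  using periodic_int[of \<alpha> "2 * pi" t k] periodic by simp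

lemma height_cont: "isCont (\<lambda>t. \<alpha> t \<bullet> dir \<phi>) t"
  by (rule DERIV_isCont[OF height_deriv])

lemma height_cont_direction: "isCont (\<lambda>\<phi>. \<alpha> t \<bullet> dir \<phi>) \<phi>"
  unfolding inner_dir by (intro continuous_intros)

lemma angle_close: "\<epsilon> > 0 \<Longrightarrow> \<forall>\<^sub>F s in at t. \<bar>\<theta> s - \<theta> t\<bar> < \<epsilon>"
  using DERIV_isCont[OF deriv_angle, of t]
  by (auto simp: isCont_def tendsto_iff dist_real_def)

lemma angle_isolated: "\<forall>\<^sub>F s in at t. \<theta> s \<noteq> \<theta> t"
  by (rule eventually_neq_of_eventually_deriv_nonzero[OF deriv_angle angular_speed_zeros_isolated])

text \<open>Near a zero of the cosine, \<open>\<theta>\<close> differs from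
  \<open>\<theta> t\<close> by a nonzero amount below \<open>pi\<close>, too little to reach another
  zero; elsewhere continuity suffices.\<close>

lemma critical_points_isolated: "\<forall>\<^sub>F s in at t. cos (\<theta> s - \<phi>) \<noteq> 0"
proof (cases "cos (\<theta> t - \<phi>) = 0")
  case True
  show ?thesis
    using angle_close[OF pi_gt_zero, of t] angle_isolated[of t]
  proof eventually_elim
    case (elim s)
    then show ?case using cos_zeros_close[OF _ True, of "\<theta> s - \<phi>"] by auto
  qed
next
  case False
  have "isCont (\<lambda>s. cos (\<theta> s - \<phi>)) t"
    using DERIV_isCont[OF deriv_angle, of t] by (intro continuous_intros)
  then show ?thesis using False unfolding isCont_def by (rule tendsto_imp_eventually_ne)
qed

text \<open>Isolated critical points prevent a height from being repeated close to \<open>t\<close>.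
  Strictness is what makes the maximum survive a perturbation of the direction.\<close>

lemma local_max_imp_strict:
  assumes "is_local_max (\<lambda>t. \<alpha> t \<bullet> dir \<phi>) t"
  shows "\<forall>\<^sub>F s in at t. \<alpha> s \<bullet> dir \<phi> < \<alpha> t \<bullet> dir \<phi>"
proof -
  have "\<forall>\<^sub>F s in at t. \<rho> s * cos (\<theta> s - \<phi>) \<noteq> 0"
    using critical_points_isolated[of \<phi> t]
    by eventually_elim (use speed_pos in \<open>simp add: less_imp_neq[symmetric]\<close>)
  then have "\<forall>\<^sub>F s in at t. \<alpha> s \<bullet> dir \<phi> \<noteq> \<alpha> t \<bullet> dir \<phi>"
    by (rule eventually_neq_of_eventually_deriv_nonzero[OF height_deriv])
  moreover have "\<forall>\<^sub>F s in at t. \<alpha> s \<bullet> dir \<phi> \<le> \<alpha> t \<bullet> dir \<phi>"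
    using assms unfolding is_local_max_def by (rule eventually_nhds_conv_at[THEN iffD1, THEN conjunct1])
  ultimately show ?thesis by eventually_elim simp
qed

lemma local_max_critical:
  assumes "is_local_max (\<lambda>t. \<alpha> t \<bullet> dir \<phi>) t"
  shows "cos (\<theta> t - \<phi>) = 0"
proof -
  obtain d where "d > 0" "\<And>s. dist s t < d \<Longrightarrow> \<alpha> s \<bullet> dir \<phi> \<le> \<alpha> t \<bullet> dir \<phi>"
    using assms by (auto simp: is_local_max_def eventually_nhds_metric)
  then have "\<rho> t * cos (\<theta> t - \<phi>) = 0"
    by (intro DERIV_local_max[OF height_deriv, of d]) (auto simp: dist_real_def abs_minus_commute)
  then show ?thesis using speed_pos[of t] by simp
qed

text \<open>Infinitely many critical points would accumulate in the compact interval
  \<open>{0..2 * pi}\<close>, against their isolation.\<close>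

lemma finite_local_maxima: "finite {t \<in> {0..<2 * pi}. is_local_max (\<lambda>t. \<alpha> t \<bullet> dir \<phi>) t}"
proof (rule finite_subset)
  show "finite ({0..2 * pi} \<inter> {t. cos (\<theta> t - \<phi>) = 0})"
    using critical_points_isolated
    by (intro finite_not_islimpt_in_compact) (auto simp: islimpt_iff_eventually)
qed (use local_max_critical in auto)

lemma num_local_maxima_dir:
  "num_local_maxima \<alpha> (dir \<phi>) =
     enat (card {t \<in> {0..<2 * pi}. is_local_max (\<lambda>t. \<alpha> t \<bullet> dir \<phi>) t})"
  unfolding num_local_maxima_def Let_def using finite_local_maxima by simp

section \<open>A sign change yields two directions with different counts\<close>

subsection \<open>Curves with a sign change of the curvature\<close>

text \<open>At a sign change of \<open>\<omega>\<close> the angle has a strict local extremum, so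
  the curve turns away from its tangent direction to the same side before and after
  \<open>t\<close>. Of the two normal directions, the one that makes the slope positive on both
  sides is taken.\<close>

lemma changes_sign_imp_tangential_crossing:
  assumes "changes_sign_at \<omega> t"
  obtains \<phi> where "cos (\<theta> t - \<phi>) = 0" "\<forall>\<^sub>F s in at t. cos (\<theta> s - \<phi>) > 0"
    "\<And>\<epsilon>. \<epsilon> > 0 \<Longrightarrow> \<exists>\<psi>. \<bar>\<psi> - \<phi>\<bar> < \<epsilon> \<and> cos (\<theta> t - \<psi>) < 0"
proof -
  note result = that
  \<comment> \<open>The factor \<open>\<sigma>\<close> treats a maximum (1) and a minimum (-1) of
    \<open>\<theta>\<close> together.\<close>
  have *: thesis
    if \<sigma>: "\<sigma> = 1 \<or> \<sigma> = - 1" and ev: "\<forall>\<^sub>F s in at t. \<sigma> * \<theta> s < \<sigma> * \<theta> t" for \<sigma> :: real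
  proof (rule result)
    show "cos (\<theta> t - (\<theta> t - \<sigma> * (pi / 2))) = 0" using \<sigma> by auto
    show "\<forall>\<^sub>F s in at t. cos (\<theta> s - (\<theta> t - \<sigma> * (pi / 2))) > 0"
      using ev angle_close[OF pi_gt_zero, of t]
    proof eventually_elim
      case (elim s)
      have "0 < sin (\<sigma> * \<theta> t - \<sigma> * \<theta> s)"
        using elim \<sigma> by (intro sin_gt_zero) auto
      also have "\<dots> = cos (\<theta> s - (\<theta> t - \<sigma> * (pi / 2)))"
        using \<sigma> by (auto simp: sin_diff cos_diff cos_add sin_add algebra_simps)
      finally show ?case .
    qed
    fix \<epsilon> :: real assume "\<epsilon> > 0"
    \<comment> \<open>The bound 1 keeps \<open>d\<close> below \<open>pi\<close>, so that
      \<open>sin d\<close> is positive; halving keeps it strictly below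
      \<open>\<epsilon>\<close>.\<close>
    define d where "d = min (\<epsilon> / 2) 1"
    have d: "0 < d" "d < \<epsilon>" "d < pi" using \<open>\<epsilon> > 0\<close> pi_gt3 by (auto simp: d_def)
    have "cos (\<theta> t - (\<theta> t - \<sigma> * (pi / 2) - \<sigma> * d)) = - sin d"
      using \<sigma> by (auto simp: cos_add cos_diff)
    also have "\<dots> < 0" using d by (simp add: sin_gt_zero)
    finally show "\<exists>\<psi>. \<bar>\<psi> - (\<theta> t - \<sigma> * (pi / 2))\<bar> < \<epsilon> \<and> cos (\<theta> t - \<psi>) < 0"
      using d \<sigma> by (intro exI[of _ "\<theta> t - \<sigma> * (pi / 2) - \<sigma> * d"]) auto
  qed
  from assms consider
      "\<forall>\<^sub>F s in at_left t. \<omega> s > 0" "\<forall>\<^sub>F s in at_right t. \<omega> s < 0"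
    | "\<forall>\<^sub>F s in at_left t. - \<omega> s > 0" "\<forall>\<^sub>F s in at_right t. - \<omega> s < 0"
    by (auto simp: changes_sign_at_def)
  then show thesis
  proof cases
    case 1
    then have "\<forall>\<^sub>F s in at t. \<theta> s < \<theta> t"
      by (rule eventually_deriv_pos_neg_imp_less[OF deriv_angle])
    then show thesis using *[of 1] by simp
  next
    case 2
    then have "\<forall>\<^sub>F s in at t. - \<theta> s < - \<theta> t"
      using eventually_deriv_pos_neg_imp_less[OF DERIV_minus[OF deriv_angle]] by blast
    then show thesis using *[of "-1"] by simp
  qed
qed

text \<open>The hypotheses compare only three heights, so for a fixed \<open>\<delta>\<close> they
  remain true under small rotations of the direction.\<close>

lemma persistent_local_max:
  assumes "\<delta> > 0" "\<alpha> (t - \<delta>) \<bullet> dir \<phi> < \<alpha> t \<bullet> dir \<phi>" "\<alpha> (t + \<delta>) \<bullet> dir \<phi> < \<alpha> t \<bullet> dir \<phi>"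
  shows "\<exists>s. \<bar>s - t\<bar> < \<delta> \<and> is_local_max (\<lambda>t. \<alpha> t \<bullet> dir \<phi>) s"
proof -
  have "\<exists>s. t - \<delta> < s \<and> s < t + \<delta> \<and> is_local_max (\<lambda>t. \<alpha> t \<bullet> dir \<phi>) s"
    using assms height_cont
    by (intro local_max_between[where c = t]) (auto intro: continuous_at_imp_continuous_on)
  then obtain s where "t - \<delta> < s" "s < t + \<delta>" "is_local_max (\<lambda>t. \<alpha> t \<bullet> dir \<phi>) s"
    using assms(1) by auto
  then show ?thesis by (intro exI[of _ s]) auto
qed

text \<open>The negative slope at \<open>t\<close> makes the curve higher just to the left, while
  \<open>t - \<delta>\<close> is still lower than \<open>t\<close>; a maximum is enclosed between
  them.\<close>

lemma new_local_max:
  assumes "\<delta> > 0" "\<alpha> (t - \<delta>) \<bullet> dir \<phi> < \<alpha> t \<bullet> dir \<phi>" "cos (\<theta> t - \<phi>) < 0"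
  shows "\<exists>s. \<bar>s - t\<bar> < \<delta> \<and> is_local_max (\<lambda>t. \<alpha> t \<bullet> dir \<phi>) s"
proof -
  have "\<rho> t * cos (\<theta> t - \<phi>) < 0" using speed_pos assms(3) by (simp add: mult_pos_neg)
  then obtain d where d: "d > 0" "\<And>h. 0 < h \<Longrightarrow> h < d \<Longrightarrow> \<alpha> t \<bullet> dir \<phi> < \<alpha> (t - h) \<bullet> dir \<phi>"
    using DERIV_neg_dec_left[OF height_deriv] by blast
  define c where "c = t - min d \<delta> / 2"
  have c: "t - \<delta> < c" "c < t" using d(1) assms(1) by (auto simp: c_def min_def)
  have "\<alpha> t \<bullet> dir \<phi> < \<alpha> c \<bullet> dir \<phi>"
    unfolding c_def using d(1) assms(1) by (intro d(2)) auto
  then have "\<exists>s. t - \<delta> < s \<and> s < t \<and> is_local_max (\<lambda>t. \<alpha> t \<bullet> dir \<phi>) s"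
    using c assms(2) height_cont
    by (intro local_max_between[where c = c]) (auto intro: continuous_at_imp_continuous_on)
  then obtain s where "t - \<delta> < s" "s < t + \<delta>" "is_local_max (\<lambda>t. \<alpha> t \<bullet> dir \<phi>) s"
    using assms(1) by auto
  then show ?thesis by (intro exI[of _ s]) auto
qed

lemma changes_sign_imp_num_local_maxima_neq:
  assumes "changes_sign_at \<omega> t0"
  shows "\<exists>\<phi> \<psi>. num_local_maxima \<alpha> (dir \<phi>) \<noteq> num_local_maxima \<alpha> (dir \<psi>)"
proof -
  obtain \<phi> where crit: "cos (\<theta> t0 - \<phi>) = 0" and pos: "\<forall>\<^sub>F s in at t0. cos (\<theta> s - \<phi>) > 0"
    and near: "\<And>\<epsilon>. \<epsilon> > 0 \<Longrightarrow> \<exists>\<psi>. \<bar>\<psi> - \<phi>\<bar> < \<epsilon> \<and> cos (\<theta> t0 - \<psi>) < 0"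
    using changes_sign_imp_tangential_crossing[OF assms] by blast
  define M where "M = (\<lambda>\<phi>. {t \<in> {0..<2 * pi}. is_local_max (\<lambda>t. \<alpha> t \<bullet> dir \<phi>) t})"
  have fin: "finite (M \<phi>)" for \<phi> unfolding M_def by (rule finite_local_maxima)
  have "\<forall>\<^sub>F s in at t0. \<rho> s * cos (\<theta> s - \<phi>) > 0"
    using pos by eventually_elim (simp add: speed_pos)
  then have left: "\<forall>\<^sub>F s in at_left t0. \<alpha> s \<bullet> dir \<phi> < \<alpha> t0 \<bullet> dir \<phi>"
    and right: "\<forall>\<^sub>F s in at_right t0. \<alpha> t0 \<bullet> dir \<phi> < \<alpha> s \<bullet> dir \<phi>"
    using eventually_deriv_pos_imp_less_left[OF height_deriv]
      eventually_deriv_pos_imp_greater_right[OF height_deriv]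
    by (auto simp: eventually_at_split)
  \<comment> \<open>The height increases strictly through \<open>t0\<close>, so adding
    \<open>t0\<close> to the maxima for \<open>\<phi>\<close> raises the cardinality by one.\<close>
  have not_max: "\<not> is_local_max (\<lambda>t. \<alpha> t \<bullet> dir \<phi>) t0"
  proof
    assume "is_local_max (\<lambda>t. \<alpha> t \<bullet> dir \<phi>) t0"
    then have "\<forall>\<^sub>F s in at_right t0. \<alpha> s \<bullet> dir \<phi> < \<alpha> t0 \<bullet> dir \<phi>"
      using local_max_imp_strict by (auto simp: eventually_at_split)
    with right have "\<forall>\<^sub>F s in at_right t0. False" by eventually_elim simp
    then show False by (simp add: trivial_limit_at_right_real)
  qed
  \<comment> \<open>Each point of \<open>P\<close> will produce a local maximum for the rotated
    direction. Since \<open>t0\<close> may lie outside \<open>{0..<2 * pi}\<close>, its separation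
    from the others modulo the period has to be proved.\<close>
  define P where "P = insert t0 (M \<phi>)"
  have max_shift: "is_local_max (\<lambda>t. \<alpha> t \<bullet> dir \<psi>) (t + of_int k * (2 * pi))"
    if "is_local_max (\<lambda>t. \<alpha> t \<bullet> dir \<psi>) t" for t \<psi> k
    using that by (rule is_local_max_shift) (rule height_periodic)
  \<comment> \<open>\<open>sin ((t - t') / 2)\<close> measures the distance of \<open>t\<close> and \<open>t'\<close> on the circle: it vanishes iff
    \<open>t\<close> and \<open>t'\<close> are congruent modulo \<open>2\<pi>\<close>.\<close>
  have t0_separate: "sin ((t - t0) / 2) \<noteq> 0" if "t \<in> M \<phi>" for t
  proof
    assume "sin ((t - t0) / 2) = 0"
    then obtain k where "(t - t0) / 2 = of_int k * pi" by (auto simp: sin_zero_iff_int2)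
    then have "t0 = t + of_int (- k) * (2 * pi)" by (simp add: field_simps)
    then show False using not_max max_shift[of \<phi> t "- k"] that by (simp add: M_def)
  qed
  have separate: "sin ((t - t') / 2) \<noteq> 0" if "t \<in> P" "t' \<in> P" "t \<noteq> t'" for t t'
  proof -
    have "sin ((t - t') / 2) \<noteq> 0" if "t \<in> M \<phi>" "t' \<in> M \<phi>"
      using sin_eq_0_pi[of "(t - t') / 2"] that \<open>t \<noteq> t'\<close> by (auto simp: M_def)
    moreover have "sin ((t0 - t') / 2) \<noteq> 0" if "t' \<in> M \<phi>"
      using t0_separate[OF that] sin_minus[of "(t0 - t') / 2"] by (simp add: minus_divide_left)
    ultimately show ?thesis using that t0_separate by (auto simp: P_def)
  qed
  \<comment> \<open>Finiteness of \<open>P\<close> gives one radius for all points. The last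
    condition prevents maxima found near different points from coinciding on the circle.\<close>
  have "\<forall>\<^sub>F \<delta> in at_right 0. 0 < \<delta> \<and>
      (\<forall>t\<in>M \<phi>. \<alpha> (t - \<delta>) \<bullet> dir \<phi> < \<alpha> t \<bullet> dir \<phi> \<and> \<alpha> (t + \<delta>) \<bullet> dir \<phi> < \<alpha> t \<bullet> dir \<phi>) \<and>
      \<alpha> (t0 - \<delta>) \<bullet> dir \<phi> < \<alpha> t0 \<bullet> dir \<phi> \<and>
      (\<forall>t\<in>P. \<forall>t'\<in>P. t \<noteq> t' \<longrightarrow> \<delta> < \<bar>sin ((t - t') / 2)\<bar>)"
  proof (intro eventually_conj eventually_ball_finite ballI)
    show "\<forall>\<^sub>F \<delta> in at_right (0::real). 0 < \<delta>" by (rule eventually_at_right_less)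
    show "finite (M \<phi>)" "finite P" "finite P" using fin by (auto simp: P_def)
    show "\<forall>\<^sub>F \<delta> in at_right 0. \<alpha> (t0 - \<delta>) \<bullet> dir \<phi> < \<alpha> t0 \<bullet> dir \<phi>"
      using eventually_at_left_to_right_0[OF left] .
  next
    fix t assume "t \<in> M \<phi>"
    then have "\<forall>\<^sub>F s in at t. \<alpha> s \<bullet> dir \<phi> < \<alpha> t \<bullet> dir \<phi>"
      by (auto simp: M_def intro: local_max_imp_strict)
    then have l: "\<forall>\<^sub>F s in at_left t. \<alpha> s \<bullet> dir \<phi> < \<alpha> t \<bullet> dir \<phi>"
      and r: "\<forall>\<^sub>F s in at_right t. \<alpha> s \<bullet> dir \<phi> < \<alpha> t \<bullet> dir \<phi>"
      by (auto simp: eventually_at_split)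
    show "\<forall>\<^sub>F \<delta> in at_right 0. \<alpha> (t - \<delta>) \<bullet> dir \<phi> < \<alpha> t \<bullet> dir \<phi>"
      using eventually_at_left_to_right_0[OF l] .
    show "\<forall>\<^sub>F \<delta> in at_right 0. \<alpha> (t + \<delta>) \<bullet> dir \<phi> < \<alpha> t \<bullet> dir \<phi>"
      using eventually_at_right_to_right_0[OF r] .
  next
    fix t t' assume "t \<in> P" "t' \<in> P"
    show "\<forall>\<^sub>F \<delta> in at_right 0. t \<noteq> t' \<longrightarrow> \<delta> < \<bar>sin ((t - t') / 2)\<bar>"
    proof (cases "t = t'")
      case False
      then have "0 < \<bar>sin ((t - t') / 2)\<bar>" using separate \<open>t \<in> P\<close> \<open>t' \<in> P\<close> by simp
      then show ?thesis
        unfolding eventually_at_right_field by (intro exI[of _ "\<bar>sin ((t - t') / 2)\<bar>"]) auto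
    qed simp
  qed
  then obtain \<delta> where \<delta>: "0 < \<delta>"
    and max0: "\<And>t. t \<in> M \<phi> \<Longrightarrow> \<alpha> (t - \<delta>) \<bullet> dir \<phi> < \<alpha> t \<bullet> dir \<phi>"
      "\<And>t. t \<in> M \<phi> \<Longrightarrow> \<alpha> (t + \<delta>) \<bullet> dir \<phi> < \<alpha> t \<bullet> dir \<phi>"
    and new0: "\<alpha> (t0 - \<delta>) \<bullet> dir \<phi> < \<alpha> t0 \<bullet> dir \<phi>"
    and apart: "\<And>t t'. t \<in> P \<Longrightarrow> t' \<in> P \<Longrightarrow> t \<noteq> t' \<Longrightarrow> \<delta> < \<bar>sin ((t - t') / 2)\<bar>"
    using eventually_happens'[OF trivial_limit_at_right_real] by blast
  \<comment> \<open>With \<open>\<delta>\<close> fixed, these are finitely many strict inequalities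
    between functions continuous in the direction.\<close>
  have "\<forall>\<^sub>F \<psi> in nhds \<phi>.
      (\<forall>t\<in>M \<phi>. \<alpha> (t - \<delta>) \<bullet> dir \<psi> < \<alpha> t \<bullet> dir \<psi> \<and> \<alpha> (t + \<delta>) \<bullet> dir \<psi> < \<alpha> t \<bullet> dir \<psi>) \<and>
      \<alpha> (t0 - \<delta>) \<bullet> dir \<psi> < \<alpha> t0 \<bullet> dir \<psi>"
    using max0 new0 fin
    by (intro eventually_conj eventually_ball_finite ballI eventually_less_of_isCont
        height_cont_direction) auto
  then obtain \<epsilon> where "\<epsilon> > 0" and \<epsilon>: "\<And>\<psi>. \<bar>\<psi> - \<phi>\<bar> < \<epsilon> \<Longrightarrow>
      (\<forall>t\<in>M \<phi>. \<alpha> (t - \<delta>) \<bullet> dir \<psi> < \<alpha> t \<bullet> dir \<psi> \<and> \<alpha> (t + \<delta>) \<bullet> dir \<psi> < \<alpha> t \<bullet> dir \<psi>) \<and>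
      \<alpha> (t0 - \<delta>) \<bullet> dir \<psi> < \<alpha> t0 \<bullet> dir \<psi>"
    by (auto simp: eventually_nhds_metric dist_real_def)
  obtain \<psi> where \<psi>: "\<bar>\<psi> - \<phi>\<bar> < \<epsilon>" "cos (\<theta> t0 - \<psi>) < 0" using near[OF \<open>\<epsilon> > 0\<close>] by blast
  have "\<exists>s. \<bar>s - t\<bar> < \<delta> \<and> is_local_max (\<lambda>t. \<alpha> t \<bullet> dir \<psi>) s" if "t \<in> P" for t
    using that \<epsilon>[OF \<psi>(1)] \<psi>(2) \<delta> persistent_local_max new_local_max unfolding P_def by blast
  then obtain S where S: "\<And>t. t \<in> P \<Longrightarrow> \<bar>S t - t\<bar> < \<delta>"
      "\<And>t. t \<in> P \<Longrightarrow> is_local_max (\<lambda>t. \<alpha> t \<bullet> dir \<psi>) (S t)"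
    by metis
  \<comment> \<open>\<open>R t\<close> is the representative of \<open>S t\<close> in
    \<open>{0..<2 * pi}\<close>.\<close>
  define R where "R = (\<lambda>t. S t + of_int (- \<lfloor>S t / (2 * pi)\<rfloor>) * (2 * pi))"
  have range: "0 \<le> R t" "R t < 2 * pi" for t
    unfolding R_def using floor_divide_lower[of "2 * pi" "S t"] floor_divide_upper[of "2 * pi" "S t"]
    by (simp_all add: distrib_right)
  have "R ` P \<subseteq> M \<psi>"
  proof (rule image_subsetI)
    fix t assume "t \<in> P"
    then have "is_local_max (\<lambda>t. \<alpha> t \<bullet> dir \<psi>) (R t)"
      unfolding R_def by (intro max_shift S(2))
    then show "R t \<in> M \<psi>" using range[of t] by (simp add: M_def)
  qed
  moreover have "inj_on R P"
  proof (rule inj_onI, rule ccontr)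
    fix t t' assume t: "t \<in> P" "t' \<in> P" "R t = R t'" "t \<noteq> t'"
    define k where "k = \<lfloor>S t / (2 * pi)\<rfloor> - \<lfloor>S t' / (2 * pi)\<rfloor>"
    have "S t - S t' = 2 * (of_int k * pi)"
      using t(3) by (simp add: R_def k_def algebra_simps)
    then have "(S t - S t') / 2 = of_int k * pi" by simp
    then have "sin ((S t - S t') / 2) = 0" by (auto simp: sin_zero_iff_int2)
    \<comment> \<open>Each point moves by less than \<open>\<delta>\<close>, so half the difference
      also changes by less than \<open>\<delta>\<close>. Points that become congruent were therefore
      too close at the start.\<close>
    then have "\<bar>sin ((t - t') / 2)\<bar> \<le> \<bar>(t - t') / 2 - (S t - S t') / 2\<bar>"
      using abs_sin_diff_le[of "(t - t') / 2" "(S t - S t') / 2"] by simp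
    also have "\<dots> < \<delta>" using S(1)[OF t(1)] S(1)[OF t(2)] by (simp add: abs_less_iff field_simps)
    finally show False using apart[OF t(1,2,4)] by simp
  qed
  ultimately have "card P \<le> card (M \<psi>)" using fin by (intro card_inj_on_le)
  moreover have "card P = Suc (card (M \<phi>))"
    using not_max fin by (simp add: P_def M_def)
  ultimately have "card (M \<phi>) \<noteq> card (M \<psi>)" by simp
  then have "num_local_maxima \<alpha> (dir \<phi>) \<noteq> num_local_maxima \<alpha> (dir \<psi>)"
    unfolding num_local_maxima_dir M_def by simp
  then show ?thesis by blast
qed

section \<open>Without sign changes, every direction gives the absolute turning number\<close>

subsection \<open>Curves without sign change of the curvature\<close>

text \<open>Isolated zeros give \<open>\<omega>\<close> a sign on each side of every point, and the
  two agree when there is no sign change. The points of positive and of negative sign form disjoint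
  open sets covering the connected line, so one set is empty.\<close>

lemma no_sign_change_imp_constant_sign:
  assumes no: "\<And>t. \<not> changes_sign_at \<omega> t"
  obtains \<sigma> :: real where "\<sigma> = 1 \<or> \<sigma> = - 1" "\<And>t. \<forall>\<^sub>F s in at t. \<sigma> * \<omega> s > 0"
proof -
  let ?A = "{t. \<forall>\<^sub>F s in at t. \<omega> s > 0}" and ?B = "{t. \<forall>\<^sub>F s in at t. \<omega> s < 0}"
  have "t \<in> ?A \<union> ?B" for t
    using no[of t] angular_speed_zeros_isolated[of t] eventually_sign_left[OF angular_speed_cont]
      eventually_sign_right[OF angular_speed_cont]
    unfolding changes_sign_at_def eventually_at_split by blast
  then have cover: "UNIV \<subseteq> ?A \<union> ?B" by blast
  have disjoint: "?A \<inter> ?B \<inter> UNIV = {}"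
  proof -
    have False if "\<forall>\<^sub>F s in at t. \<omega> s > 0" "\<forall>\<^sub>F s in at t. \<omega> s < 0" for t
    proof -
      have "\<forall>\<^sub>F s in at t. False" using that by eventually_elim simp
      then show False by simp
    qed
    then show ?thesis by blast
  qed
  have "?A \<inter> UNIV = {} \<or> ?B \<inter> UNIV = {}"
    using connected_UNIV cover disjoint by (intro connectedD) (auto intro: open_eventually_at)
  then show thesis
  proof
    assume "?B \<inter> UNIV = {}"
    then show thesis using cover by (intro that[of 1]) auto
  next
    assume "?A \<inter> UNIV = {}"
    then show thesis using cover by (intro that[of "-1"]) auto
  qed
qed

text \<open>The derivative is nonnegative everywhere by continuity, hence weak monotonicity.
  Strictness is gained immediately to the right of \<open>a\<close> and kept up to
  \<open>b\<close>.\<close>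

lemma strict_mono_signed_angle:
  assumes "\<And>t. \<forall>\<^sub>F s in at t. \<sigma> * \<omega> s > 0"
  shows "strict_mono (\<lambda>t. \<sigma> * \<theta> t)"
proof (rule strict_monoI)
  have D: "((\<lambda>t. \<sigma> * \<theta> t) has_real_derivative \<sigma> * \<omega> t) (at t)" for t
    by (rule DERIV_cmult[OF deriv_angle])
  have "0 \<le> \<sigma> * \<omega> t" for t
    using angular_speed_cont assms by (intro eventually_at_pos_imp_nonneg continuous_intros)
  then have mono: "\<sigma> * \<theta> a \<le> \<sigma> * \<theta> b" if "a \<le> b" for a b
    using that D by (intro DERIV_nonneg_imp_nondecreasing[of a b "\<lambda>t. \<sigma> * \<theta> t"]) blast+
  fix a b :: real assume "a < b"
  have "\<forall>\<^sub>F s in at_right a. \<sigma> * \<theta> a < \<sigma> * \<theta> s"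
    using assms[of a] by (intro eventually_deriv_pos_imp_greater_right[OF D])
      (simp add: eventually_at_split)
  moreover have "\<forall>\<^sub>F s in at_right a. s < b"
    using \<open>a < b\<close> by (auto simp: eventually_at_right_field)
  ultimately have "\<forall>\<^sub>F s in at_right a. \<sigma> * \<theta> a < \<sigma> * \<theta> b"
    by eventually_elim (use mono in \<open>meson less_imp_le less_le_trans\<close>)
  then show "\<sigma> * \<theta> a < \<sigma> * \<theta> b"
    by (simp add: trivial_limit_at_right_real)
qed

text \<open>The slope of \<open>\<tau>\<close> times the height equals \<open>\<rho> s * sin
  (\<sigma> * \<theta> t - \<sigma> * \<theta> s)\<close>, which monotonicity makes positive before
  \<open>t\<close> and negative after it. The factor \<open>\<tau>\<close> covers maxima and minima
  at once.\<close>

lemma extremum_of_sin: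
  assumes \<sigma>: "\<sigma> = 1 \<or> \<sigma> = - 1" and mono: "strict_mono (\<lambda>t. \<sigma> * \<theta> t)"
    and \<tau>: "\<tau> = 1 \<or> \<tau> = - 1" "sin (\<sigma> * \<theta> t - \<sigma> * \<phi>) = \<tau>"
  shows "\<forall>\<^sub>F s in at t. \<tau> * (\<alpha> s \<bullet> dir \<phi>) < \<tau> * (\<alpha> t \<bullet> dir \<phi>)"
proof (rule eventually_deriv_pos_neg_imp_less)
  show "((\<lambda>s. \<tau> * (\<alpha> s \<bullet> dir \<phi>)) has_real_derivative \<tau> * (\<rho> s * cos (\<theta> s - \<phi>))) (at s)" for s
    by (rule DERIV_cmult[OF height_deriv])
  have "cos (\<sigma> * \<theta> t - \<sigma> * \<phi>) = 0"
    using \<tau> sin_cos_squared_add[of "\<sigma> * \<theta> t - \<sigma> * \<phi>"] by auto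
  have slope: "\<tau> * (\<rho> s * cos (\<theta> s - \<phi>)) = \<rho> s * sin (\<sigma> * \<theta> t - \<sigma> * \<theta> s)" for s
  proof -
    have "cos (\<theta> s - \<phi>) = cos (\<sigma> * (\<theta> s - \<phi>))"
      using \<sigma> cos_minus[of "\<theta> s - \<phi>"] by auto
    also have "\<dots> = cos ((\<sigma> * \<theta> t - \<sigma> * \<phi>) - (\<sigma> * \<theta> t - \<sigma> * \<theta> s))"
      by (simp add: algebra_simps)
    also have "\<dots> = \<tau> * sin (\<sigma> * \<theta> t - \<sigma> * \<theta> s)"
      using \<tau>(2) \<open>cos (\<sigma> * \<theta> t - \<sigma> * \<phi>) = 0\<close> by (subst cos_diff) simp
    finally show ?thesis using \<tau>(1) by auto
  qed
  have close: "\<forall>\<^sub>F s in at t. \<bar>\<sigma> * \<theta> t - \<sigma> * \<theta> s\<bar> < pi"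
    using angle_close[OF pi_gt_zero, of t] by eventually_elim (use \<sigma> in auto)
  have left: "\<forall>\<^sub>F s in at_left t. s < t" by (simp add: eventually_at_filter)
  show "\<forall>\<^sub>F s in at_left t. \<tau> * (\<rho> s * cos (\<theta> s - \<phi>)) > 0"
    using close[unfolded eventually_at_split, THEN conjunct1] left
  proof eventually_elim
    case (elim s)
    then have "sin (\<sigma> * \<theta> t - \<sigma> * \<theta> s) > 0"
      using strict_monoD[OF mono, of s t] by (intro sin_gt_zero) auto
    then show ?case unfolding slope using speed_pos by simp
  qed
  show "\<forall>\<^sub>F s in at_right t. \<tau> * (\<rho> s * cos (\<theta> s - \<phi>)) < 0"
    using close[unfolded eventually_at_split, THEN conjunct2] eventually_at_right_less[of t]
  proof eventually_elim
    case (elim s)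
    then have "sin (\<sigma> * \<theta> s - \<sigma> * \<theta> t) > 0"
      using strict_monoD[OF mono, of t s] by (intro sin_gt_zero) auto
    then have "sin (\<sigma> * \<theta> t - \<sigma> * \<theta> s) < 0"
      using sin_minus[of "\<sigma> * \<theta> s - \<sigma> * \<theta> t"] by simp
    then show ?case unfolding slope using speed_pos by (simp add: mult_pos_neg)
  qed
qed

text \<open>At a critical point the sine is 1 or -1, and -1 gives a strict minimum. Thus maxima
  occur exactly where the monotone angle passes one residue class modulo
  \<open>2 * pi\<close>.\<close>

lemma local_max_iff_sin:
  assumes \<sigma>: "\<sigma> = 1 \<or> \<sigma> = - 1" and mono: "strict_mono (\<lambda>t. \<sigma> * \<theta> t)"
  shows "is_local_max (\<lambda>t. \<alpha> t \<bullet> dir \<phi>) t \<longleftrightarrow> sin (\<sigma> * \<theta> t - \<sigma> * \<phi>) = 1"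
proof
  assume max: "is_local_max (\<lambda>t. \<alpha> t \<bullet> dir \<phi>) t"
  have "cos (\<sigma> * \<theta> t - \<sigma> * \<phi>) = cos (\<theta> t - \<phi>)"
    using \<sigma> cos_minus[of "\<theta> t - \<phi>"] by auto
  then have "(sin (\<sigma> * \<theta> t - \<sigma> * \<phi>))\<^sup>2 = 1"
    using local_max_critical[OF max] sin_cos_squared_add[of "\<sigma> * \<theta> t - \<sigma> * \<phi>"] by simp
  then consider "sin (\<sigma> * \<theta> t - \<sigma> * \<phi>) = 1" | "sin (\<sigma> * \<theta> t - \<sigma> * \<phi>) = - 1"
    by (auto simp: power2_eq_1_iff)
  then show "sin (\<sigma> * \<theta> t - \<sigma> * \<phi>) = 1"
  proof cases
    case 2
    have "\<forall>\<^sub>F s in at t. - 1 * (\<alpha> s \<bullet> dir \<phi>) < - 1 * (\<alpha> t \<bullet> dir \<phi>)"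
      using extremum_of_sin[OF \<sigma> mono _ 2] by blast
    with local_max_imp_strict[OF max] have "\<forall>\<^sub>F s in at t. False" by eventually_elim simp
    then show ?thesis by simp
  qed
next
  assume "sin (\<sigma> * \<theta> t - \<sigma> * \<phi>) = 1"
  then have "\<forall>\<^sub>F s in at t. \<alpha> s \<bullet> dir \<phi> < \<alpha> t \<bullet> dir \<phi>"
    using extremum_of_sin[OF \<sigma> mono, of 1] by simp
  then show "is_local_max (\<lambda>t. \<alpha> t \<bullet> dir \<phi>) t"
    unfolding is_local_max_def eventually_nhds_conv_at by (auto elim: eventually_mono)
qed

text \<open>Periodicity of \<open>\<alpha>\<close> makes the velocities at 0 and
  \<open>2 * pi\<close> equal. Their positive lengths then agree, so the angles have the same sine
  and cosine.\<close>

lemma total_turning: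
  obtains n :: int where "\<theta> (2 * pi) = \<theta> 0 + 2 * pi * of_int n"
proof -
  have "(\<alpha> has_vector_derivative
      vector [\<rho> (0 + 2 * pi) * cos (\<theta> (0 + 2 * pi)), \<rho> (0 + 2 * pi) * sin (\<theta> (0 + 2 * pi))])
      (at (0 + 2 * pi))"
    by (rule deriv_curve)
  then have "((\<lambda>t. \<alpha> (t + 2 * pi)) has_vector_derivative
      vector [\<rho> (0 + 2 * pi) * cos (\<theta> (0 + 2 * pi)), \<rho> (0 + 2 * pi) * sin (\<theta> (0 + 2 * pi))]) (at 0)"
    using vector_diff_chain_at[of "\<lambda>t. t + 2 * pi" 1 0 \<alpha>]
      has_vector_derivative_add_const[of "\<lambda>t. t" "2 * pi" 1 "at 0"]
    by (simp add: o_def has_vector_derivative_id)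
  then have eq: "(vector [\<rho> (2 * pi) * cos (\<theta> (2 * pi)), \<rho> (2 * pi) * sin (\<theta> (2 * pi))] :: real^2)
      = vector [\<rho> 0 * cos (\<theta> 0), \<rho> 0 * sin (\<theta> 0)]"
    using deriv_curve[of 0] by (simp add: periodic vector_derivative_unique_at)
  then have c: "\<rho> (2 * pi) * cos (\<theta> (2 * pi)) = \<rho> 0 * cos (\<theta> 0)"
    and s: "\<rho> (2 * pi) * sin (\<theta> (2 * pi)) = \<rho> 0 * sin (\<theta> 0)"
    by (simp_all add: vec_eq_iff forall_2)
  have sq: "(\<rho> t)\<^sup>2 = (\<rho> t * cos (\<theta> t))\<^sup>2 + (\<rho> t * sin (\<theta> t))\<^sup>2" for t
    by (simp add: power_mult_distrib flip: distrib_left)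
  have "(\<rho> (2 * pi))\<^sup>2 = (\<rho> 0)\<^sup>2"
    unfolding sq[of "2 * pi"] sq[of 0] c s ..
  then have "\<rho> (2 * pi) = \<rho> 0"
    using speed_pos by (meson less_imp_le power2_eq_imp_eq)
  then have "sin (\<theta> (2 * pi)) = sin (\<theta> 0) \<and> cos (\<theta> (2 * pi)) = cos (\<theta> 0)"
    using c s speed_pos[of 0] by simp
  then show thesis using that sin_cos_eq_iff by blast
qed

text \<open>A half-open interval of length \<open>2 * pi * n\<close> contains exactly
  \<open>n\<close> points of any residue class modulo \<open>2 * pi\<close>; the direction only
  selects the class.\<close>

lemma no_sign_change_imp_num_local_maxima_eq:
  assumes "\<And>t. \<not> changes_sign_at \<omega> t"
  shows "num_local_maxima \<alpha> (dir \<phi>) = num_local_maxima \<alpha> (dir \<psi>)"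
proof -
  obtain \<sigma> :: real where \<sigma>: "\<sigma> = 1 \<or> \<sigma> = - 1" and pos: "\<And>t. \<forall>\<^sub>F s in at t. \<sigma> * \<omega> s > 0"
    using no_sign_change_imp_constant_sign[OF assms] by blast
  define h where "h = (\<lambda>t. \<sigma> * \<theta> t)"
  have mono: "strict_mono h" unfolding h_def by (rule strict_mono_signed_angle[OF pos])
  have cont: "continuous_on A h" for A
    unfolding h_def using deriv_angle
    by (intro continuous_intros) (meson DERIV_isCont continuous_at_imp_continuous_on)
  obtain m :: int where "\<theta> (2 * pi) = \<theta> 0 + 2 * pi * of_int m"
    by (rule total_turning)
  then have "\<exists>n::int. h (2 * pi) = h 0 + 2 * pi * of_int n"
    using \<sigma> unfolding h_def by (auto intro: exI[of _ m] exI[of _ "- m"])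
  then obtain n :: int where n: "h (2 * pi) = h 0 + 2 * pi * of_int n" by blast
  have "card {t \<in> {0..<2 * pi}. is_local_max (\<lambda>t. \<alpha> t \<bullet> dir \<phi>) t} = nat n" for \<phi>
  proof -
    define d where "d = \<sigma> * \<phi> + pi / 2"
    define A where "A = {t \<in> {0..<2 * pi}. is_local_max (\<lambda>t. \<alpha> t \<bullet> dir \<phi>) t}"
    \<comment> \<open>The least \<open>k\<close> for which \<open>d + 2 * pi * k\<close> reaches
      \<open>h 0\<close>.\<close>
    define c where "c = \<lceil>(h 0 - d) / (2 * pi)\<rceil>"
    have max_iff: "is_local_max (\<lambda>t. \<alpha> t \<bullet> dir \<phi>) t \<longleftrightarrow> (\<exists>k::int. h t = d + 2 * pi * of_int k)" for t
    proof -
      have "is_local_max (\<lambda>t. \<alpha> t \<bullet> dir \<phi>) t \<longleftrightarrow> cos (h t - d) = 1"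
        using local_max_iff_sin[OF \<sigma> mono[unfolded h_def]]
        by (simp add: h_def d_def cos_diff sin_diff cos_add sin_add algebra_simps)
      also have "\<dots> \<longleftrightarrow> (\<exists>k::int. h t = d + 2 * pi * of_int k)"
        unfolding cos_one_2pi_int by (auto simp: algebra_simps)
      finally show ?thesis .
    qed
    have k_iff: "h 0 \<le> d + 2 * pi * of_int k \<and> d + 2 * pi * of_int k < h (2 * pi) \<longleftrightarrow> k \<in> {c..<c + n}"
      for k :: int
    proof -
      have "h 0 \<le> d + 2 * pi * of_int k \<longleftrightarrow> (h 0 - d) / (2 * pi) \<le> of_int k"
        by (simp add: field_simps)
      also have "\<dots> \<longleftrightarrow> c \<le> k" by (simp add: c_def ceiling_le_iff)
      finally have lower: "h 0 \<le> d + 2 * pi * of_int k \<longleftrightarrow> c \<le> k" .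
      \<comment> \<open>The upper end is the lower end shifted by \<open>n\<close> whole turns, so
        the first excluded index is exactly \<open>c + n\<close>.\<close>
      have "d + 2 * pi * of_int k < h (2 * pi) \<longleftrightarrow> of_int (k - n) < (h 0 - d) / (2 * pi)"
        unfolding n by (simp add: field_simps)
      also have "\<dots> \<longleftrightarrow> k - n < c" by (simp only: c_def less_ceiling_iff)
      finally show ?thesis using lower by auto
    qed
    have "h ` A = (\<lambda>k. d + 2 * pi * of_int k) ` {c..<c + n}"
    proof (intro equalityI subsetI)
      fix y assume "y \<in> h ` A"
      then obtain t k where t: "0 \<le> t" "t < 2 * pi" "y = h t" "h t = d + 2 * pi * of_int k"
        by (auto simp: A_def max_iff)
      have "h 0 \<le> h t" "h t < h (2 * pi)"
        using t strict_mono_less_eq[OF mono, of 0 t] strict_mono_less[OF mono, of t "2 * pi"] by auto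
      then have "k \<in> {c..<c + n}" using k_iff[of k] t(4) by simp
      then show "y \<in> (\<lambda>k. d + 2 * pi * of_int k) ` {c..<c + n}" using t by blast
    next
      fix y assume "y \<in> (\<lambda>k. d + 2 * pi * real_of_int k) ` {c..<c + n}"
      then obtain k where k: "k \<in> {c..<c + n}" "y = d + 2 * pi * of_int k" by blast
      then have y: "h 0 \<le> y" "y < h (2 * pi)" using k_iff by auto
      then obtain t where t: "0 \<le> t" "t \<le> 2 * pi" "h t = y"
        using IVT'[of h 0 y "2 * pi"] cont by auto
      \<comment> \<open>The intermediate value theorem allows the right endpoint; the strict bound
        on \<open>y\<close> excludes it.\<close>
      then have "t < 2 * pi" using y(2) by (cases "t = 2 * pi") auto
      then have "t \<in> A" using t k(2) by (auto simp: A_def max_iff)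
      then show "y \<in> h ` A" using t(3) by blast
    qed
    then have "card (h ` A) = card ((\<lambda>k. d + 2 * pi * real_of_int k) ` {c..<c + n})" by simp
    moreover have "card (h ` A) = card A"
      using mono by (intro card_image) (meson inj_on_subset strict_mono_imp_inj_on subset_UNIV)
    moreover have "card ((\<lambda>k. d + 2 * pi * real_of_int k) ` {c..<c + n}) = nat n"
      by (subst card_image) (auto simp: inj_on_def)
    ultimately show ?thesis by (simp add: A_def)
  qed
  then show ?thesis by (simp only: num_local_maxima_dir)
qed

lemma num_local_maxima_constant_iff:
  "(\<forall>v w. norm v = 1 \<longrightarrow> norm w = 1 \<longrightarrow> num_local_maxima \<alpha> v = num_local_maxima \<alpha> w)
    \<longleftrightarrow> (\<forall>t. \<not> changes_sign_at \<omega> t)"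
  using changes_sign_imp_num_local_maxima_neq no_sign_change_imp_num_local_maxima_eq norm_dir
    dir_exists by metis

end

section \<open>Lifting the velocity through the complex exponential, and the conclusion\<close>

subsection \<open>Existence of the tangent angle\<close>

text \<open>Integrating the logarithmic derivative \<open>b t / z t\<close> gives a logarithm
  without choosing a branch. The product of \<open>z\<close> and \<open>exp (- L)\<close> has
  derivative zero, and its constant value is absorbed into \<open>L\<close>.\<close>

lemma complex_exp_lift:
  fixes z b :: "real \<Rightarrow> complex"
  assumes z: "\<And>t. (z has_vector_derivative b t) (at t)" and b: "\<And>t. isCont b t"
    and nz: "\<And>t. z t \<noteq> 0"
  obtains L where "\<And>t. z t = exp (L t)" "\<And>t. (L has_vector_derivative b t / z t) (at t)"
proof -
  have "isCont z t" for t using z has_vector_derivative_continuous by blast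
  then have "isCont (\<lambda>t. b t / z t) t" for t using b nz by (intro continuous_intros)
  then obtain L where L: "\<And>t. (L has_vector_derivative b t / z t) (at t)"
    using einterval_antiderivative[of "-\<infinity>" \<infinity> "\<lambda>t. b t / z t"] by auto
  have "((\<lambda>t. z t * exp (- L t)) has_derivative (\<lambda>_. 0)) (at t within UNIV)" for t
  proof -
    have exp: "((\<lambda>x. exp (- x)) has_field_derivative - exp (- L t)) (at (L t))"
      by (auto intro!: derivative_eq_intros)
    then have "((\<lambda>t. exp (- L t)) has_vector_derivative b t / z t * - exp (- L t)) (at t)"
      using field_vector_diff_chain_at[OF L exp] by (simp add: o_def)
    from has_vector_derivative_mult[OF z this] show ?thesis
      using nz[of t] by (simp add: has_vector_derivative_def algebra_simps)
  qed
  then obtain c where c: "\<And>t. z t * exp (- L t) = c"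
    using has_derivative_zero_constant[OF convex_UNIV, of "\<lambda>t. z t * exp (- L t)"] by auto
  have "c \<noteq> 0" using c[of 0] nz[of 0] by auto
  then obtain l where l: "c = exp l" by (metis exp_Ln)
  show thesis
  proof (rule that)
    show "z t = exp (l + L t)" for t
      using c[of t] by (simp add: l exp_add exp_minus field_simps)
    show "((\<lambda>t. l + L t) has_vector_derivative b t / z t) (at t)" for t
      using L by (auto intro!: derivative_eq_intros)
  qed
qed

text \<open>With the velocity read as a complex number \<open>exp (L t)\<close>, the real part of
  \<open>L\<close> is the logarithm of the speed and the imaginary part is the tangent
  angle.\<close>

lemma immersed_closed_curve_tangent_angle:
  fixes \<alpha> :: "real \<Rightarrow> real^2"
  assumes immersed: "immersed_closed_curve \<alpha>" and isolated: "discrete (inflection_points \<alpha>)"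
  obtains \<rho> \<theta> where "curve_with_tangent_angle \<alpha> \<rho> \<theta>
    (\<lambda>t. signed_curvature \<alpha> t * norm (vector_derivative \<alpha> (at t)))"
proof -
  define v where "v = (\<lambda>t. vector_derivative \<alpha> (at t))"
  define a where "a = (\<lambda>t. vector_derivative v (at t))"
  have nth: "nth_vector_derivative 0 \<alpha> = \<alpha>" "nth_vector_derivative 1 \<alpha> = v"
      "nth_vector_derivative 2 \<alpha> = a"
    by (simp_all add: nth_vector_derivative_def v_def a_def numeral_2_eq_2)
  have smooth: "nth_vector_derivative k \<alpha> differentiable (at t)" for k t
    using immersed by (simp add: immersed_closed_curve_def smooth_curve_def)
  have dv: "(\<alpha> has_vector_derivative v t) (at t)" for t
    using smooth[of 0 t] unfolding nth v_def by (simp add: vector_derivative_works)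
  have da: "(v has_vector_derivative a t) (at t)" for t
    using smooth[of 1 t] unfolding nth a_def by (simp add: vector_derivative_works)
  have cv: "isCont v t" and ca: "isCont a t" for t
    using smooth[of 1 t] smooth[of 2 t] unfolding nth by (auto intro: differentiable_imp_continuous_within)
  have vnz: "v t \<noteq> 0" for t using immersed by (simp add: immersed_closed_curve_def v_def)
  define z where "z = (\<lambda>t. Complex (v t $ 1) (v t $ 2))"
  define b where "b = (\<lambda>t. Complex (a t $ 1) (a t $ 2))"
  have comp: "((\<lambda>t. v t $ i) has_vector_derivative a t $ i) (at t)" for i t
    by (rule bounded_linear.has_vector_derivative[OF bounded_linear_vec_nth da])
  have "(z has_vector_derivative b t) (at t)" for t
    using comp by (simp add: z_def b_def has_vector_derivative_complex_iff
        has_real_derivative_iff_has_vector_derivative)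
  moreover have "isCont b t" for t
  proof -
    have "b = (\<lambda>t. of_real (a t $ 1) + \<i> * of_real (a t $ 2))"
      by (simp add: b_def fun_eq_iff complex_eq_iff)
    then show ?thesis using ca[of t] by (auto intro!: continuous_intros)
  qed
  moreover have "z t \<noteq> 0" for t
    using vnz[of t] by (auto simp: z_def complex_eq_iff vec_eq_iff forall_2)
  ultimately obtain L where L: "\<And>t. z t = exp (L t)" "\<And>t. (L has_vector_derivative b t / z t) (at t)"
    using complex_exp_lift[of z b] by blast
  define \<kappa> where "\<kappa> = signed_curvature \<alpha>"
  have \<kappa>: "\<kappa> t = (v t $ 1 * a t $ 2 - v t $ 2 * a t $ 1) / norm (v t) ^ 3" for t
    by (simp add: \<kappa>_def signed_curvature_def nth[simplified] Let_def)
  have \<kappa>_cont: "isCont \<kappa> t" for t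
    unfolding \<kappa> [abs_def] using cv ca vnz by (intro continuous_intros) auto
  have "curve_with_tangent_angle \<alpha> (\<lambda>t. exp (Re (L t))) (\<lambda>t. Im (L t)) (\<lambda>t. \<kappa> t * norm (v t))"
  proof
    fix t
    have "v t = vector [Re (exp (L t)), Im (exp (L t))]"
      unfolding L(1)[symmetric] by (simp add: z_def vec_eq_iff forall_2)
    then show "(\<alpha> has_vector_derivative
        vector [exp (Re (L t)) * cos (Im (L t)), exp (Re (L t)) * sin (Im (L t))]) (at t)"
      using dv[of t] by (simp add: Re_exp Im_exp)
    show "0 < exp (Re (L t))" by simp
    have n: "norm (v t) ^ 2 = (v t $ 1)\<^sup>2 + (v t $ 2)\<^sup>2"
      unfolding power2_norm_eq_inner by (simp add: inner_vec_def sum_2 power2_eq_square)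
    \<comment> \<open>The imaginary part of acceleration over velocity is their determinant divided
      by the squared speed, that is, curvature times speed.\<close>
    have "Im (b t / z t) = (v t $ 1 * a t $ 2 - v t $ 2 * a t $ 1) / norm (v t) ^ 2"
      by (simp add: Im_divide z_def b_def n algebra_simps)
    also have "\<dots> = \<kappa> t * norm (v t)"
      using vnz[of t] by (simp add: \<kappa> power2_eq_square power3_eq_cube)
    finally have "Im (b t / z t) = \<kappa> t * norm (v t)" .
    then show "((\<lambda>t. Im (L t)) has_real_derivative \<kappa> t * norm (v t)) (at t)"
      using L(2)[of t] by (simp add: has_vector_derivative_complex_iff)
    show "isCont (\<lambda>t. \<kappa> t * norm (v t)) t"
      using \<kappa>_cont cv by (intro continuous_intros)
    \<comment> \<open>Discreteness speaks only about neighbourhoods of the zeros; at other points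
      continuity is used.\<close>
    have "\<forall>\<^sub>F s in at t. \<kappa> s \<noteq> 0"
    proof (cases "\<kappa> t = 0")
      case True
      then show ?thesis
        using isolated by (auto simp: discrete_def isolated_in_altdef inflection_points_def \<kappa>_def)
    next
      case False
      then show ?thesis using \<kappa>_cont unfolding isCont_def by (rule tendsto_imp_eventually_ne[rotated])
    qed
    then show "\<forall>\<^sub>F s in at t. \<kappa> s * norm (v s) \<noteq> 0"
      by eventually_elim (simp add: vnz)
    show "\<alpha> (t + 2 * pi) = \<alpha> t" using immersed by (simp add: immersed_closed_curve_def)
  qed
  then show thesis using that by (simp add: \<kappa>_def v_def)
qed

text \<open>Since \<open>\<omega>\<close> is the curvature times a positive speed, both change sign
  at the same parameters, and by continuity these are inflection points. Spiral form thus means that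
  \<open>\<omega>\<close> has no sign change, the condition characterized in the locale.\<close>

theorem mainTheorem2:
  fixes K :: "(real^3) set" and \<gamma> :: "real \<Rightarrow> real^3"
    and p e1 e2 :: "real^3" and \<alpha> :: "real \<Rightarrow> real^2"
  assumes knot: "knot_parametrization \<gamma> K"
    and plane: "orthonormal_pair e1 e2"
    and projection: "\<alpha> = plane_projection p e1 e2 \<circ> \<gamma>"
    and immersed: "immersed_closed_curve \<alpha>"
    and isolated_inflections: "discrete (inflection_points \<alpha>)"
  shows "spiral_form \<alpha> \<longleftrightarrow>
           (\<forall>v w. norm v = 1 \<longrightarrow> norm w = 1 \<longrightarrow> num_local_maxima \<alpha> v = num_local_maxima \<alpha> w)"
proof -
  define \<omega> where "\<omega> = (\<lambda>t. signed_curvature \<alpha> t * norm (vector_derivative \<alpha> (at t)))"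
  have speed: "norm (vector_derivative \<alpha> (at t)) > 0" for t
    using immersed by (simp add: immersed_closed_curve_def)
  obtain \<rho> \<theta> where "curve_with_tangent_angle \<alpha> \<rho> \<theta> \<omega>"
    using immersed_closed_curve_tangent_angle[OF immersed isolated_inflections]
    unfolding \<omega>_def by blast
  then interpret curve_with_tangent_angle \<alpha> \<rho> \<theta> \<omega> .
  have "changes_sign_at (signed_curvature \<alpha>) t \<longleftrightarrow> changes_sign_at \<omega> t" for t
    using speed by (simp add: changes_sign_at_def \<omega>_def mult_less_0_iff zero_less_mult_iff
        less_imp_not_less)
  moreover have "signed_curvature \<alpha> t = 0 \<longleftrightarrow> \<omega> t = 0" for t
    using speed[of t] by (simp add: \<omega>_def)
  ultimately have "spiral_form \<alpha> \<longleftrightarrow> (\<forall>t. \<not> changes_sign_at \<omega> t)"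
    using changes_sign_at_imp_zero[OF angular_speed_cont]
    by (auto simp: spiral_form_def s_inflection_points_def inflection_points_def)
  then show ?thesis unfolding num_local_maxima_constant_iff .
qed

end
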